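(* Let $R_1(z)=\sum_j(z-\lambda_j)_+$ be the first Riesz-mean of the Laplacian eigenvalues $\lambda_j$ (counted with multiplicity) on the circle $\mathbb{S}^1$. For all $z\ge0$, $$ R_1(z)\leq\frac43\left(z+\frac1{12}\right)^{\frac32}. $$ Moreover, for each $l\in\mathbb{N}=\{0,1,2,\dots\}$ there exists $z_l$ in the open interval $(l^2,(l+1)^2)$ such that equality holds at $z=z_l$.
   Context: $\mathbb{S}^1$ is the unit circle (length $2\pi$). The distinct eigenvalues of $-\Delta$ on $\mathbb{S}^1$ are $l^2$, $l\in\mathbb{N}$, with multiplicity $1$ for $l=0$ and $2$ for $l\ge1$; thus $R_1(z)=z_++2\sum_{l\ge1}(z-l^2)_+$, where $a_+=\max(a,0)$. *)

theory Defs
  imports "HOL-Analysis.Analysis" "HOL-Library.Function_Algebras"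
begin

text \<open>
  The circle is \<^term>\<open>sphere (0::complex) 1\<close>, with arc length parametrisation \<^term>\<open>cis\<close>.
  A real function on the circle is represented by its extension by zero to all of
  \<^typ>\<open>complex\<close>, so that distinct functions on the circle have distinct representatives
  and dimensions of function spaces are the right ones.
\<close>

definition smooth_circle_functions :: "(complex \<Rightarrow> real) set" where
  "smooth_circle_functions =
     {f. (\<forall>p. p \<notin> sphere 0 1 \<longrightarrow> f p = 0) \<and>
         (\<forall>n t. (deriv ^^ n) (\<lambda>s. f (cis s)) differentiable at t)}"

text \<open>
  At a point \<open>p\<close> of the circle, \<open>t \<mapsto> p * cis t\<close> is the arc length parametrisation
  starting at \<open>p\<close>.
\<close>

definition circle_laplacian :: "(complex \<Rightarrow> real) \<Rightarrow> complex \<Rightarrow> real" where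
  "circle_laplacian f p = (deriv ^^ 2) (\<lambda>t. f (p * cis t)) 0"

definition circle_eigenspace :: "real \<Rightarrow> (complex \<Rightarrow> real) set" where
  "circle_eigenspace \<mu> =
     {f \<in> smooth_circle_functions. \<forall>p\<in>sphere 0 1. - circle_laplacian f p = \<mu> * f p}"

definition circle_eigenvalues :: "real set" where
  "circle_eigenvalues = {\<mu>. \<exists>f\<in>circle_eigenspace \<mu>. f \<noteq> 0}"

abbreviation fun_scale :: "real \<Rightarrow> (complex \<Rightarrow> real) \<Rightarrow> complex \<Rightarrow> real" where
  "fun_scale \<equiv> (\<lambda>c f x. c * f x)"

lemma vector_space_fun_scale: "vector_space fun_scale"
  by unfold_locales (auto simp: fun_eq_iff algebra_simps)

definition circle_multiplicity :: "real \<Rightarrow> nat" where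
  "circle_multiplicity \<mu> = vector_space.dim fun_scale (circle_eigenspace \<mu>)"

text \<open>
  The sum over all eigenvalues counted with multiplicity is written as a sum over the distinct
  eigenvalues weighted by their multiplicities.
\<close>

definition circle_riesz_mean1 :: "real \<Rightarrow> real" where
  "circle_riesz_mean1 z =
     (\<Sum>\<^sub>\<infinity>\<mu>\<in>circle_eigenvalues. real (circle_multiplicity \<mu>) * max (z - \<mu>) 0)"

end

theory Submission
  imports Defs
begin

text \<open>
  Along the arc length parametrisation, an eigenfunction for \<open>\<mu>\<close> is a \<open>2 * pi\<close>-periodic solution
  \<open>g\<close> of \<open>g'' = - \<mu> * g\<close>.  For \<open>\<mu> \<le> 0\<close> the function \<open>g * g'\<close> is nondecreasing and periodic, so it
  is constant, which leaves only constant solutions, and no nonzero one if \<open>\<mu> < 0\<close>.  For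
  \<open>\<mu> = k\<^sup>2 > 0\<close> conservation of energy gives \<open>g t = A * cos (k * t) + B * sin (k * t)\<close>, and
  periodicity says that the rotation by the angle \<open>2 * pi * k\<close> fixes \<open>(A, B)\<close>, so \<open>k\<close> is an
  integer.  Hence the eigenvalues are the squares \<open>l\<^sup>2\<close>, with multiplicity \<open>1\<close> for \<open>l = 0\<close> and \<open>2\<close>
  otherwise (lemmas \<open>circle_eigenvalues_eq\<close>, \<open>circle_multiplicity_square\<close>).

  The Riesz mean is therefore piecewise linear.  On \<open>[L\<^sup>2, (L + 1)\<^sup>2]\<close>, with \<open>m = 2 * L + 1\<close> and
  \<open>s = sqrt (z + 1 / 12)\<close>, it equals \<open>m * s\<^sup>2 - m ^ 3 / 12\<close>, and
  \<open>4 / 3 * s ^ 3 - (m * s\<^sup>2 - m ^ 3 / 12) = (2 * s - m)\<^sup>2 * (4 * s + m) / 12 \<ge> 0\<close>.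
  Thus each linear piece is a tangent to the bounding curve, touching it where \<open>s = m / 2\<close>, that is
  at \<open>z = L\<^sup>2 + L + 1 / 6\<close>, inside the interval of that piece.
\<close>

section \<open>Periodic solutions of the harmonic oscillator equation\<close>

lemma deriv_shift: "deriv (\<lambda>t. g (a + t)) = (\<lambda>t. deriv (g :: real \<Rightarrow> real) (a + t))"
  by (simp add: deriv_def DERIV_shift add.commute fun_eq_iff)

lemma periodic_derivative:
  fixes g g' :: "real \<Rightarrow> real"
  assumes "\<And>t. (g has_real_derivative g' t) (at t)" and "\<And>t. g (t + T) = g t"
  shows "g' (t + T) = g' t"
proof -
  have "((\<lambda>x. g (x + T)) has_real_derivative g' (t + T)) (at t)"
    using assms(1)[of "t + T"] by (simp add: DERIV_shift)
  then show ?thesis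
    using assms DERIV_unique[OF _ assms(1)] by simp
qed

text \<open>
  Since \<open>(g * g')' = g'\<^sup>2 - \<mu> * g\<^sup>2 \<ge> 0\<close> and \<open>g * g'\<close> is periodic, this nonnegative derivative
  vanishes identically.
\<close>

lemma periodic_solution_nonpos:
  fixes g g' :: "real \<Rightarrow> real"
  assumes g: "\<And>t. (g has_real_derivative g' t) (at t)"
    and g': "\<And>t. (g' has_real_derivative - \<mu> * g t) (at t)"
    and per: "\<And>t. g (t + T) = g t" and "T > 0" and "\<mu> \<le> 0"
  shows "g' t = 0" and "\<mu> * g t = 0"
proof -
  define P where "P = (\<lambda>t. g t * g' t)"
  have P: "(P has_real_derivative (g' x)\<^sup>2 + (- \<mu>) * (g x)\<^sup>2) (at x)" for x
    unfolding P_def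
    by (rule derivative_eq_intros g g' refl)+ (simp add: power2_eq_square)
  have nonneg: "0 \<le> (g' x)\<^sup>2" "0 \<le> (- \<mu>) * (g x)\<^sup>2" for x
    using \<open>\<mu> \<le> 0\<close> by (auto simp: mult_nonpos_nonneg)
  have mono: "P x \<le> P y" if "x \<le> y" for x y
    by (rule DERIV_nonneg_imp_nondecreasing[OF that])
      (use P nonneg add_nonneg_nonneg in blast)
  have perP: "P (x + T) = P x" for x
    using per periodic_derivative[OF g per] by (simp add: P_def)
  have "P t = P y" if "\<bar>t - y\<bar> < T" for y
  proof -
    have "P (t - T) \<le> P y" "P y \<le> P (t + T)"
      using that by (auto intro!: mono)
    then show ?thesis using perP[of t] perP[of "t - T"] by simp
  qed
  then have "(g' t)\<^sup>2 + (- \<mu>) * (g t)\<^sup>2 = 0"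
    using DERIV_local_const[OF P \<open>T > 0\<close>] by blast
  then have "(g' t)\<^sup>2 = 0" "(- \<mu>) * (g t)\<^sup>2 = 0"
    using nonneg[of t] by linarith+
  then show "g' t = 0" "\<mu> * g t = 0" by auto
qed

text \<open>
  The difference of the two sides solves the same equation with zero initial data, so its energy
  \<open>h'\<^sup>2 + k\<^sup>2 * h\<^sup>2\<close>, which is constant, is zero.
\<close>

lemma oscillator_solution:
  fixes g g' :: "real \<Rightarrow> real"
  assumes g: "\<And>t. (g has_real_derivative g' t) (at t)"
    and g': "\<And>t. (g' has_real_derivative - k\<^sup>2 * g t) (at t)" and "k \<noteq> 0"
  shows "g t = g 0 * cos (k * t) + g' 0 / k * sin (k * t)"
proof -
  define h where "h = (\<lambda>t. g t - (g 0 * cos (k * t) + g' 0 / k * sin (k * t)))"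
  define h' where "h' = (\<lambda>t. g' t - (g' 0 * cos (k * t) - k * g 0 * sin (k * t)))"
  have h: "(h has_real_derivative h' x) (at x)" for x
    unfolding h_def h'_def
    by (rule derivative_eq_intros g refl)+ (use \<open>k \<noteq> 0\<close> in \<open>simp add: field_simps\<close>)
  have h': "(h' has_real_derivative - k\<^sup>2 * h x) (at x)" for x
    unfolding h_def h'_def
    by (rule derivative_eq_intros g' refl)+
      (use \<open>k \<noteq> 0\<close> in \<open>simp add: field_simps power2_eq_square\<close>)
  have "((\<lambda>x. (h' x)\<^sup>2 + k\<^sup>2 * (h x)\<^sup>2) has_real_derivative 0) (at x)" for x
    by (rule derivative_eq_intros h h' refl)+ (simp add: algebra_simps)
  then have "(h' t)\<^sup>2 + k\<^sup>2 * (h t)\<^sup>2 = (h' 0)\<^sup>2 + k\<^sup>2 * (h 0)\<^sup>2"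
    using DERIV_isconst_all[of "\<lambda>x. (h' x)\<^sup>2 + k\<^sup>2 * (h x)\<^sup>2"] by blast
  then have "(h' t)\<^sup>2 + (k * h t)\<^sup>2 = 0"
    by (simp add: h_def h'_def power_mult_distrib)
  then have "h t = 0"
    using \<open>k \<noteq> 0\<close> by (simp add: sum_power2_eq_zero_iff)
  then show ?thesis by (simp add: h_def)
qed

text \<open>
  In the basis of the initial data \<open>(A, B)\<close>, translation by the period acts as the rotation by the
  angle \<open>2 * pi * k\<close>, and a rotation with a nonzero fixed vector is trivial.
\<close>

lemma periodic_oscillation_integer_frequency:
  fixes A B k :: real
  assumes eq: "\<And>t. g t = A * cos (k * t) + B * sin (k * t)"
    and per: "\<And>t. g (t + 2 * pi) = g t" and "k > 0" and nz: "A \<noteq> 0 \<or> B \<noteq> 0"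
  shows "\<exists>l::nat. k = real l"
proof -
  define c s where "c = cos (k * (2 * pi))" and "s = sin (k * (2 * pi))"
  have 1: "A * c + B * s = A"
    using per[of 0] by (simp add: eq c_def s_def)
  \<comment> \<open>A quarter of an oscillation after time \<open>0\<close> the solution takes the value \<open>B\<close>.\<close>
  have "k * (pi / (2 * k) + 2 * pi) = k * (2 * pi) + pi / 2" "k * (pi / (2 * k)) = pi / 2"
    using \<open>k > 0\<close> by (simp_all add: field_simps)
  then have 2: "B * c - A * s = B"
    using per[of "pi / (2 * k)"] by (simp only: eq) (simp add: c_def s_def cos_add sin_add)
  have "(A\<^sup>2 + B\<^sup>2) * c = A * (A * c + B * s) + B * (B * c - A * s)"
    by (simp add: algebra_simps power2_eq_square)
  also have "\<dots> = A\<^sup>2 + B\<^sup>2"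
    by (simp only: 1 2 power2_eq_square)
  finally have "c = 1"
    using nz by (auto simp: sum_power2_eq_zero_iff)
  then obtain n :: int where "k * (2 * pi) = real_of_int n * 2 * pi"
    by (auto simp: c_def cos_one_2pi_int)
  then have "k = real_of_int n" by simp
  with \<open>k > 0\<close> have "k = real (nat n)" by simp
  then show ?thesis ..
qed

section \<open>Eigenfunctions of the circle Laplacian\<close>

definition circle_harmonic :: "nat \<Rightarrow> real \<Rightarrow> real \<Rightarrow> complex \<Rightarrow> real" where
  "circle_harmonic l A B p =
     (if p \<in> sphere 0 1 then A * Re (p ^ l) + B * Im (p ^ l) else 0)"

lemma circle_harmonic_cis:
  "circle_harmonic l A B (cis t) = A * cos (real l * t) + B * sin (real l * t)"
  by (simp add: circle_harmonic_def Complex.DeMoivre)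

lemma circle_harmonic_zero: "circle_harmonic l 0 0 = 0"
  by (simp add: circle_harmonic_def fun_eq_iff)

lemma sphere_obtain_cis:
  assumes "p \<in> sphere (0::complex) 1"
  obtains t where "p = cis t"
  using assms cis_Arg[of p] by (metis dist_0_norm mem_sphere norm_zero sgn_eq div_by_1 of_real_1 zero_neq_one)

lemma eq_circle_harmonicI:
  assumes "\<forall>p. p \<notin> sphere 0 1 \<longrightarrow> f p = 0"
    and "\<And>t. f (cis t) = A * cos (real l * t) + B * sin (real l * t)"
  shows "f = circle_harmonic l A B"
proof
  fix p show "f p = circle_harmonic l A B p"
  proof (cases "p \<in> sphere 0 1")
    case True
    then obtain t where "p = cis t" by (rule sphere_obtain_cis)
    then show ?thesis by (simp add: assms(2) circle_harmonic_cis)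
  next
    case False
    then show ?thesis using assms(1) by (simp add: circle_harmonic_def)
  qed
qed

lemma circle_laplacian_cis:
  "circle_laplacian f (cis a) = (deriv ^^ 2) (\<lambda>s. f (cis s)) a"
proof -
  define g where "g = (\<lambda>s. f (cis s))"
  have "(\<lambda>t. f (cis a * cis t)) = (\<lambda>t. g (a + t))"
    by (simp add: cis_mult g_def)
  then show ?thesis
    unfolding g_def[symmetric]
    by (simp add: circle_laplacian_def numeral_2_eq_2 deriv_shift[of g] deriv_shift[of "deriv g"])
qed

lemma circle_eigenspace_iff:
  "f \<in> circle_eigenspace \<mu> \<longleftrightarrow>
     (\<forall>p. p \<notin> sphere 0 1 \<longrightarrow> f p = 0) \<and>
     (\<forall>n t. (deriv ^^ n) (\<lambda>s. f (cis s)) differentiable at t) \<and>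
     (\<forall>t. (deriv ^^ 2) (\<lambda>s. f (cis s)) t = - \<mu> * f (cis t))"
proof -
  have "(\<forall>p\<in>sphere 0 1. - circle_laplacian f p = \<mu> * f p) \<longleftrightarrow>
        (\<forall>t. - circle_laplacian f (cis t) = \<mu> * f (cis t))"
    by (metis (no_types) sphere_obtain_cis dist_0_norm mem_sphere norm_cis)
  also have "\<dots> \<longleftrightarrow> (\<forall>t. (deriv ^^ 2) (\<lambda>s. f (cis s)) t = - \<mu> * f (cis t))"
    unfolding circle_laplacian_cis minus_mult_left[symmetric] by (metis minus_minus)
  finally show ?thesis
    unfolding circle_eigenspace_def smooth_circle_functions_def by blast
qed

lemma circle_eigenfunction_ode:
  assumes "f \<in> circle_eigenspace \<mu>"
    and g_def: "g = (\<lambda>s. f (cis s))"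
  shows "(g has_real_derivative deriv g t) (at t)"
    and "(deriv g has_real_derivative - \<mu> * g t) (at t)"
    and "g (t + 2 * pi) = g t"
proof -
  have sm: "(deriv ^^ n) g differentiable at t" for n t
    using assms by (simp add: circle_eigenspace_iff)
  have eq: "(deriv ^^ 2) g t = - \<mu> * g t" for t
    using assms by (simp add: circle_eigenspace_iff)
  show "(g has_real_derivative deriv g t) (at t)"
    using sm[of 0 t] by (simp add: DERIV_deriv_iff_real_differentiable)
  have "(deriv g has_real_derivative deriv (deriv g) t) (at t)"
    using sm[of 1 t] by (simp add: DERIV_deriv_iff_real_differentiable)
  then show "(deriv g has_real_derivative - \<mu> * g t) (at t)"
    using eq[of t] by (simp add: numeral_2_eq_2)
  show "g (t + 2 * pi) = g t"
    by (simp add: g_def flip: cis_mult)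
qed

lemma deriv_oscillation:
  "deriv (\<lambda>t::real. A * cos (k * t) + B * sin (k * t)) =
     (\<lambda>t. (B * k) * cos (k * t) + (- A * k) * sin (k * t))"
  by (rule ext, rule DERIV_imp_deriv) (auto intro!: derivative_eq_intros)

lemma oscillation_smooth:
  "(deriv ^^ n) (\<lambda>t::real. A * cos (k * t) + B * sin (k * t)) differentiable at x"
proof (induction n arbitrary: A B)
  case 0
  have "((\<lambda>t. A * cos (k * t) + B * sin (k * t)) has_real_derivative
      - A * k * sin (k * x) + B * k * cos (k * x)) (at x)"
    by (auto intro!: derivative_eq_intros)
  then show ?case
    using real_differentiable_def by auto
next
  case (Suc n)
  show ?case
    unfolding funpow_Suc_right o_apply deriv_oscillation by (rule Suc.IH)
qed

lemma circle_harmonic_in_eigenspace: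
  "circle_harmonic l A B \<in> circle_eigenspace ((real l)\<^sup>2)"
  unfolding circle_eigenspace_iff circle_harmonic_cis
proof (intro conjI allI oscillation_smooth)
  fix t :: real
  show "(deriv ^^ 2) (\<lambda>t. A * cos (real l * t) + B * sin (real l * t)) t =
      - (real l)\<^sup>2 * (A * cos (real l * t) + B * sin (real l * t))"
    unfolding numeral_2_eq_2 funpow.simps o_apply id_apply deriv_oscillation
    by (simp add: algebra_simps)
qed (simp add: circle_harmonic_def)

text \<open>
  The solutions left over for \<open>\<mu> \<le> 0\<close>, the constants, are the harmonics of frequency \<open>0\<close>, so that
  one form covers all eigenfunctions.
\<close>

lemma eigenfunction_is_circle_harmonic:
  assumes f: "f \<in> circle_eigenspace \<mu>" and "f \<noteq> 0"
  obtains l A B where "\<mu> = (real l)\<^sup>2" and "f = circle_harmonic l A B"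
proof -
  define g where "g = (\<lambda>s. f (cis s))"
  note ode = circle_eigenfunction_ode[OF f g_def]
  have supp: "\<forall>p. p \<notin> sphere 0 1 \<longrightarrow> f p = 0"
    using f by (simp add: circle_eigenspace_iff)
  show thesis
  proof (cases "\<mu> \<le> 0")
    case True
    have g': "deriv g t = 0" and 0: "\<mu> * g t = 0" for t
      using periodic_solution_nonpos[OF ode _ True] by simp_all
    have "g t = g 0" for t
      using DERIV_isconst_all[of g t 0] ode(1) g' by metis
    then have fh: "f = circle_harmonic 0 (g 0) 0"
      by (intro eq_circle_harmonicI supp) (simp add: g_def)
    with \<open>f \<noteq> 0\<close> have "g 0 \<noteq> 0"
      using circle_harmonic_zero by metis
    with 0[of 0] fh show thesis
      by (intro that[of 0 "g 0" 0]) auto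
  next
    case False
    define k where "k = sqrt \<mu>"
    define A B where "A = g 0" and "B = deriv g 0 / k"
    have k: "k > 0" "\<mu> = k\<^sup>2" using False by (simp_all add: k_def)
    have g: "g t = A * cos (k * t) + B * sin (k * t)" for t
      unfolding A_def B_def
      by (rule oscillator_solution[OF ode(1)]) (use ode(2) k in auto)
    have "A \<noteq> 0 \<or> B \<noteq> 0"
    proof (rule ccontr)
      assume "\<not> ?thesis"
      then have "f = circle_harmonic 0 0 0"
        using g by (intro eq_circle_harmonicI supp) (simp add: g_def)
      with \<open>f \<noteq> 0\<close> show False by (simp add: circle_harmonic_zero)
    qed
    with g ode(3) k obtain l :: nat where l: "k = real l"
      using periodic_oscillation_integer_frequency[of g A k B] by auto
    have "f = circle_harmonic l A B"
      using g by (intro eq_circle_harmonicI supp) (simp add: g_def l)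
    with k l show thesis by (intro that) auto
  qed
qed

lemma circle_eigenspace_square:
  "circle_eigenspace ((real l)\<^sup>2) = {circle_harmonic l A B | A B. True}"
proof (intro equalityI subsetI)
  fix f assume f: "f \<in> circle_eigenspace ((real l)\<^sup>2)"
  show "f \<in> {circle_harmonic l A B | A B. True}"
  proof (cases "f = 0")
    case True
    then have "f = circle_harmonic l 0 0" by (simp add: circle_harmonic_zero)
    then show ?thesis by blast
  next
    case False
    then obtain m A B where "(real l)\<^sup>2 = (real m)\<^sup>2" "f = circle_harmonic m A B"
      using eigenfunction_is_circle_harmonic[OF f] by metis
    then show ?thesis by auto
  qed
qed (auto simp: circle_harmonic_in_eigenspace)

lemma circle_eigenvalues_eq: "circle_eigenvalues = range (\<lambda>l::nat. (real l)\<^sup>2)"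
proof (intro equalityI subsetI)
  fix \<mu> assume "\<mu> \<in> circle_eigenvalues"
  then obtain f where "f \<in> circle_eigenspace \<mu>" "f \<noteq> 0"
    by (auto simp: circle_eigenvalues_def)
  then show "\<mu> \<in> range (\<lambda>l::nat. (real l)\<^sup>2)"
    by (metis eigenfunction_is_circle_harmonic rangeI)
next
  fix \<mu> assume "\<mu> \<in> range (\<lambda>l::nat. (real l)\<^sup>2)"
  then obtain l :: nat where l: "\<mu> = (real l)\<^sup>2" by blast
  have "circle_harmonic l 1 0 (cis 0) \<noteq> 0"
    unfolding circle_harmonic_cis by simp
  then have "circle_harmonic l 1 0 \<noteq> 0" by auto
  then show "\<mu> \<in> circle_eigenvalues"
    unfolding circle_eigenvalues_def l using circle_harmonic_in_eigenspace by blast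
qed

section \<open>Multiplicities\<close>

text \<open>
  The harmonics \<open>cos (l * t)\<close> and \<open>sin (l * t)\<close> are independent for \<open>l > 0\<close> because the first is
  not zero at \<open>t = 0\<close>, where the second vanishes, and the second is not the zero function.
\<close>

lemma circle_multiplicity_square:
  "circle_multiplicity ((real l)\<^sup>2) = (if l = 0 then 1 else 2)"
proof -
  interpret fs: vector_space fun_scale by (rule vector_space_fun_scale)
  define u v where "u = circle_harmonic l 1 0" and "v = circle_harmonic l 0 1"
  have comb: "circle_harmonic l A B = fun_scale A u + fun_scale B v" for A B
    by (auto simp: u_def v_def circle_harmonic_def fun_eq_iff)
  have "u (cis 0) = 1" "v (cis 0) = 0"
    unfolding u_def v_def circle_harmonic_cis by simp_all
  then have u_1: "u 1 = 1" and v_1: "v 1 = 0" by simp_all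
  have "u \<noteq> 0" using u_1 by auto
  show ?thesis
  proof (cases "l = 0")
    case True
    have "circle_eigenspace ((real l)\<^sup>2) = {fun_scale A u | A. True}"
    proof -
      have "circle_harmonic l A B = fun_scale A u" for A B
        using True by (auto simp: u_def circle_harmonic_def fun_eq_iff)
      then show ?thesis by (auto simp: circle_eigenspace_square)
    qed
    also have "\<dots> = fs.span {u}" by (auto simp: fs.span_singleton)
    finally show ?thesis
      using True \<open>u \<noteq> 0\<close> fs.dim_span_eq_card_independent[of "{u}"]
      by (simp add: circle_multiplicity_def)
  next
    case False
    have "v (cis (pi / (2 * real l))) = 1"
      unfolding v_def circle_harmonic_cis using False by simp
    then have "v \<noteq> 0" by auto
    have "u \<notin> fs.span {v}"
    proof
      assume "u \<in> fs.span {v}"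
      then obtain c where "u = fun_scale c v" by (auto simp: fs.span_singleton)
      then have "u 1 = c * v 1" by (rule fun_cong)
      then show False by (simp add: u_1 v_1)
    qed
    then have indep: "fs.independent {u, v}" and "u \<noteq> v"
      using \<open>v \<noteq> 0\<close> fs.span_base[of v "{v}"] by (auto simp: fs.independent_insert)
    have "circle_eigenspace ((real l)\<^sup>2) = fs.span {u, v}"
    proof -
      have "x \<in> fs.span {u, v} \<longleftrightarrow> (\<exists>A B. x = fun_scale A u + fun_scale B v)" for x
        unfolding fs.span_insert[of u] fs.span_singleton
        by (auto simp: diff_eq_eq add.commute image_iff simp del: plus_fun_apply)
      then show ?thesis by (auto simp: circle_eigenspace_square comb)
    qed
    then show ?thesis
      using False indep \<open>u \<noteq> v\<close> fs.dim_span_eq_card_independent[of "{u, v}"]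
      by (simp add: circle_multiplicity_def)
  qed
qed

section \<open>The Riesz mean as a piecewise linear function\<close>

lemma sum_multiplicity_linear:
  "(\<Sum>l\<le>L. real (if l = 0 then 1 else 2) * (z - (real l)\<^sup>2)) =
     (2 * real L + 1) * z - real L * (real L + 1) * (2 * real L + 1) / 3"
  by (induction L) (simp_all add: field_simps power2_eq_square)

lemma circle_riesz_mean1_piece:
  assumes "(real L)\<^sup>2 \<le> z" and "z \<le> (real L + 1)\<^sup>2"
  shows "circle_riesz_mean1 z =
    (2 * real L + 1) * z - real L * (real L + 1) * (2 * real L + 1) / 3"
proof -
  let ?sq = "\<lambda>l::nat. (real l)\<^sup>2"
  let ?F = "\<lambda>\<mu>. real (circle_multiplicity \<mu>) * max (z - \<mu>) 0"
  have "circle_riesz_mean1 z = infsum ?F (range ?sq)"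
    by (simp add: circle_riesz_mean1_def circle_eigenvalues_eq)
  also have "\<dots> = infsum ?F (?sq ` {..L})"
  proof (rule infsum_cong_neutral)
    fix \<mu> assume "\<mu> \<in> range ?sq - ?sq ` {..L}"
    then obtain l where l: "\<mu> = ?sq l" "l > L" by force
    then have "(real L + 1)\<^sup>2 \<le> ?sq l" by (intro power_mono) auto
    with assms(2) have "z \<le> ?sq l" by linarith
    then show "?F \<mu> = 0" by (simp add: l max_def)
  qed auto
  also have "\<dots> = (\<Sum>l\<le>L. ?F (?sq l))"
    by (subst infsum_finite) (auto simp: sum.reindex inj_on_def)
  also have "\<dots> = (\<Sum>l\<le>L. real (if l = 0 then 1 else 2) * (z - ?sq l))"
  proof (rule sum.cong)
    fix l assume "l \<in> {..L}"
    then have "?sq l \<le> ?sq L" by (intro power_mono) auto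
    with assms(1) have "?sq l \<le> z" by linarith
    then have "max (z - ?sq l) 0 = z - ?sq l" by (simp add: max_def)
    then show "?F (?sq l) = real (if l = 0 then 1 else 2) * (z - ?sq l)"
      by (simp add: circle_multiplicity_square)
  qed simp
  finally show ?thesis by (simp only: sum_multiplicity_linear)
qed

text \<open>
  The cubic \<open>16 * s ^ 3 - 12 * m * s\<^sup>2 + m ^ 3\<close> has the double root \<open>s = m / 2\<close>, which makes each
  linear piece a tangent.
\<close>

lemma circle_riesz_mean1_gap:
  assumes "(real L)\<^sup>2 \<le> z" and "z \<le> (real L + 1)\<^sup>2"
  defines "s \<equiv> sqrt (z + 1 / 12)" and "m \<equiv> 2 * real L + 1"
  shows "4 / 3 * (z + 1 / 12) powr (3 / 2) - circle_riesz_mean1 z =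
    (2 * s - m)\<^sup>2 * (4 * s + m) / 12"
proof -
  have "0 \<le> z" using assms(1) zero_le_power2 order_trans by blast
  then have pos: "s > 0" and s2: "s\<^sup>2 = z + 1 / 12" by (simp_all add: s_def)
  have "(z + 1 / 12) powr (3 / 2) = ((z + 1 / 12) powr (1 / 2)) powr 3"
    by (simp add: powr_powr)
  also have "\<dots> = s ^ 3"
    using \<open>0 \<le> z\<close> pos by (simp add: powr_half_sqrt s_def[symmetric])
  finally have powr: "(z + 1 / 12) powr (3 / 2) = s ^ 3" .
  have z: "z = s\<^sup>2 - 1 / 12" and L: "real L = (m - 1) / 2"
    using s2 by (simp_all add: m_def)
  show ?thesis
    unfolding powr circle_riesz_mean1_piece[OF assms(1,2)] unfolding z L
    by (simp add: field_simps power2_eq_square power3_eq_cube)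
qed

theorem proposition5p0p1:
  "(\<forall>z::real. 0 \<le> z \<longrightarrow> circle_riesz_mean1 z \<le> 4 / 3 * (z + 1 / 12) powr (3 / 2)) \<and>
   (\<forall>l::nat. \<exists>z\<in>{(real l)\<^sup>2<..<(real l + 1)\<^sup>2}.
      circle_riesz_mean1 z = 4 / 3 * (z + 1 / 12) powr (3 / 2))"
proof (intro conjI allI impI)
  fix z :: real assume "0 \<le> z"
  define L where "L = nat \<lfloor>sqrt z\<rfloor>"
  have "real L \<le> sqrt z" "sqrt z \<le> real L + 1"
    using \<open>0 \<le> z\<close> by (auto simp: L_def)
  then have "(real L)\<^sup>2 \<le> (sqrt z)\<^sup>2" "(sqrt z)\<^sup>2 \<le> (real L + 1)\<^sup>2"
    using \<open>0 \<le> z\<close> by (intro power_mono; simp)+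
  then have bounds: "(real L)\<^sup>2 \<le> z" "z \<le> (real L + 1)\<^sup>2"
    using \<open>0 \<le> z\<close> by simp_all
  have "0 \<le> sqrt (z + 1 / 12)" using \<open>0 \<le> z\<close> by simp
  then show "circle_riesz_mean1 z \<le> 4 / 3 * (z + 1 / 12) powr (3 / 2)"
    using circle_riesz_mean1_gap[OF bounds]
    by (smt (verit) divide_nonneg_pos mult_nonneg_nonneg of_nat_0_le_iff zero_le_power2)
next
  fix l :: nat
  define z where "z = (real l)\<^sup>2 + real l + 1 / 6"
  have z: "(real l)\<^sup>2 < z" "z < (real l + 1)\<^sup>2"
    by (simp_all add: z_def power2_sum)
  have "z + 1 / 12 = ((2 * real l + 1) / 2)\<^sup>2"
    by (simp add: z_def field_simps power2_eq_square)
  then have "2 * sqrt (z + 1 / 12) = 2 * real l + 1"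
    by (simp add: real_sqrt_abs)
  then have "circle_riesz_mean1 z = 4 / 3 * (z + 1 / 12) powr (3 / 2)"
    using circle_riesz_mean1_gap[of l z] z by simp
  with z show "\<exists>z\<in>{(real l)\<^sup>2<..<(real l + 1)\<^sup>2}.
      circle_riesz_mean1 z = 4 / 3 * (z + 1 / 12) powr (3 / 2)"
    by auto
qed

end
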